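(* For odd $k\ge 3$ let $\alpha'_k=\left(\frac{(k-1)(k+1)}{4k^2}\right)^{(k-1)/2}=2^{-(k-1)}\left(1-\frac1{k^2}\right)^{(k-1)/2}$. Let $k\mathrm{AND}=f_{\{k\},k}:\{-1,1\}^k\to\{0,1\}$ be the function which is $1$ exactly on the all-ones vector. Then for every odd $k\ge 3$, $\alpha(k\mathrm{AND})=\alpha'_k$, and for every even $k\ge 2$, $\alpha(k\mathrm{AND})=2\alpha'_{k+1}$.
   Context: For $\mathbf b\in\{-1,1\}^k$, $\mathrm{wt}(\mathbf b)$ is the number of coordinates equal to $1$. For nonempty $S\subseteq[k]=\{1,\dots,k\}$, $f_{S,k}:\{-1,1\}^k\to\{0,1\}$ is given by $f_{S,k}(\mathbf x)=1$ iff $\mathrm{wt}(\mathbf x)\in S$. $\Delta_k$ is the set of symmetric probability distributions $\mathcal D$ on $\{-1,1\}^k$ (vectors of equal weight are equiprobable). $\mathrm{Bern}(p)$ is the random variable equal to $1$ with probability $p$ and $-1$ with probability $1-p$; $\odot$ is the coordinatewise product. For $\mathcal D\in\Delta_k$ and $p\in[0,1]$ define $$\lambda_S(\mathcal D,p)=\mathbb E_{\mathbf a\sim\mathcal D,\ \mathbf b\sim \mathrm{Bern}(p)^k}[f_{S,k}(\mathbf a\odot\mathbf b)],\quad \mu(\mathcal D)=\mathbb E_{\mathbf b\sim\mathcal D}[b_1],\quad \beta_S(\mathcal D)=\sup_{p\in[0,1]}\lambda_S(\mathcal D,p),\quad \gamma_S(\mathcal D)=\lambda_S(\mathcal D,1).$$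 The (sketching approximation) ratio of $f_{S,k}$ is $$\alpha(f_{S,k})=\inf_{\mathcal D_N,\mathcal D_Y\in\Delta_k:\ \mu(\mathcal D_N)=\mu(\mathcal D_Y)}\frac{\beta_S(\mathcal D_N)}{\gamma_S(\mathcal D_Y)},$$ where the ratio is $+\infty$ if $\gamma_S(\mathcal D_Y)=0$. *)

theory Defs
  imports "HOL-Probability.Probability"
begin

text \<open>
  A vector in \<open>{-1,1}\<^sup>k\<close> is a function on the index set \<open>{1..k}\<close>, extended by \<open>0\<close> outside it.
  With this default value the cube is closed under the pointwise product, and \<^const>\<open>Pi_pmf\<close>
  with default \<open>0\<close> yields product distributions on the cube.
\<close>

definition cube :: "nat \<Rightarrow> (nat \<Rightarrow> int) set" where
  "cube k = PiE_dflt {1..k} 0 (\<lambda>_. {-1, 1})"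

definition wt :: "nat \<Rightarrow> (nat \<Rightarrow> int) \<Rightarrow> nat" where
  "wt k x = card {i \<in> {1..k}. x i = 1}"

definition sym_fun :: "nat set \<Rightarrow> nat \<Rightarrow> (nat \<Rightarrow> int) \<Rightarrow> real" where
  "sym_fun S k x = (if wt k x \<in> S then 1 else 0)"

definition cprod :: "(nat \<Rightarrow> int) \<Rightarrow> (nat \<Rightarrow> int) \<Rightarrow> (nat \<Rightarrow> int)" where
  "cprod a b = (\<lambda>i. a i * b i)"

definition sym_dists :: "nat \<Rightarrow> (nat \<Rightarrow> int) pmf set" where
  "sym_dists k = {D. set_pmf D \<subseteq> cube k \<and>
     (\<forall>x\<in>cube k. \<forall>y\<in>cube k. wt k x = wt k y \<longrightarrow> pmf D x = pmf D y)}"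

definition bern :: "real \<Rightarrow> int pmf" where
  "bern p = map_pmf (\<lambda>b. if b then 1 else -1) (bernoulli_pmf p)"

definition bern_vec :: "nat \<Rightarrow> real \<Rightarrow> (nat \<Rightarrow> int) pmf" where
  "bern_vec k p = Pi_pmf {1..k} 0 (\<lambda>_. bern p)"

definition lambda_val :: "nat set \<Rightarrow> nat \<Rightarrow> (nat \<Rightarrow> int) pmf \<Rightarrow> real \<Rightarrow> real" where
  "lambda_val S k D p =
     measure_pmf.expectation (pair_pmf D (bern_vec k p)) (\<lambda>(a, b). sym_fun S k (cprod a b))"

definition mu_val :: "(nat \<Rightarrow> int) pmf \<Rightarrow> real" where
  "mu_val D = measure_pmf.expectation D (\<lambda>b. real_of_int (b 1))"

definition beta_val :: "nat set \<Rightarrow> nat \<Rightarrow> (nat \<Rightarrow> int) pmf \<Rightarrow> real" where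
  "beta_val S k D = (SUP p\<in>{0..1}. lambda_val S k D p)"

definition gamma_val :: "nat set \<Rightarrow> nat \<Rightarrow> (nat \<Rightarrow> int) pmf \<Rightarrow> real" where
  "gamma_val S k D = lambda_val S k D 1"

text \<open>
  The case distinction is needed: division by \<open>0\<close> in \<^typ>\<open>real\<close> yields \<open>0\<close>, whereas the ratio
  is to be infinite whenever the denominator vanishes.
\<close>

definition sketch_ratio :: "nat set \<Rightarrow> nat \<Rightarrow> ereal" where
  "sketch_ratio S k =
     (INF (DN, DY) \<in> {(DN, DY). DN \<in> sym_dists k \<and> DY \<in> sym_dists k \<and> mu_val DN = mu_val DY}.
        if gamma_val S k DY = 0 then \<infinity> else ereal (beta_val S k DN / gamma_val S k DY))"

lemma kAND_eq_1_iff: "sym_fun {k} k x = 1 \<longleftrightarrow> (\<forall>i\<in>{1..k}. x i = 1)"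
proof
  assume "sym_fun {k} k x = 1"
  then have c: "card {i \<in> {1..k}. x i = 1} = card {1..k}"
    by (simp add: sym_fun_def wt_def split: if_splits)
  have "{i \<in> {1..k}. x i = 1} = {1..k}"
    by (rule card_subset_eq) (use c in auto)
  then show "\<forall>i\<in>{1..k}. x i = 1" by blast
next
  assume "\<forall>i\<in>{1..k}. x i = 1"
  then have "{i \<in> {1..k}. x i = 1} = {1..k}" by blast
  then show "sym_fun {k} k x = 1" by (simp add: sym_fun_def wt_def)
qed

text \<open>Only used for odd \<open>k\<close>, where the exponent \<open>(k - 1) / 2\<close> is a natural number.\<close>

definition alpha' :: "nat \<Rightarrow> real" where
  "alpha' k = ((real k - 1) * (real k + 1) / (4 * (real k)\<^sup>2)) ^ ((k - 1) div 2)"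

end

(*
  For a symmetric distribution D the value of kAND is the mean of p^w (1-p)^(k-w), where w is the
  weight of a D-random vector, and (1 + mu(D)) / 2 is the mean of w / k; the largest gamma for a given
  mu is therefore (1 + mu) / 2.  Put j = k div 2 and p = (j + 1) / (2 j + 1).  With this p, the function
  p^w (1-p)^(k-w) of w is convex and lies above the line through the origin that touches it at w = j and
  w = j + 1; this bounds the ratio from below by the value of that line at w = k.  The bound is attained
  by a distribution on the weights j and j + 1 whose masses are chosen so that this p is optimal.
*)

theory Submission
  imports Defs
begin

section \<open>Weights, products and sums over the cube\<close>

lemma finite_cube [simp]: "finite (cube k)"
  unfolding cube_def by (intro finite_PiE_dflt) auto

lemma cube_iff: "x \<in> cube k \<longleftrightarrow> (\<forall>i\<in>{1..k}. x i = 1 \<or> x i = -1) \<and> (\<forall>i. i \<notin> {1..k} \<longrightarrow> x i = 0)"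
  by (auto simp: cube_def PiE_dflt_def)

lemma wt_le: "wt k x \<le> k"
proof -
  have "wt k x \<le> card {1..k}" unfolding wt_def by (intro card_mono) auto
  then show ?thesis by simp
qed

lemma prod_cube_eq:
  fixes g :: "int \<Rightarrow> real"
  assumes "x \<in> cube k"
  shows "(\<Prod>i\<in>{1..k}. g (x i)) = g 1 ^ wt k x * g (-1) ^ (k - wt k x)"
proof -
  let ?A = "{i \<in> {1..k}. x i = 1}"
  have "(\<Prod>i\<in>{1..k}. g (x i)) = (\<Prod>i\<in>{1..k} - ?A. g (x i)) * (\<Prod>i\<in>?A. g (x i))"
    by (intro prod.subset_diff) auto
  also have "(\<Prod>i\<in>?A. g (x i)) = g 1 ^ wt k x"
    by (simp add: wt_def)
  also have "(\<Prod>i\<in>{1..k} - ?A. g (x i)) = (\<Prod>i\<in>{1..k} - ?A. g (-1))"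
    using assms by (intro prod.cong) (auto simp: cube_iff)
  also have "\<dots> = g (-1) ^ (k - wt k x)"
    unfolding wt_def by (simp only: prod_constant, subst card_Diff_subset) auto
  finally show ?thesis by simp
qed

lemma sum_cube_eq:
  assumes "x \<in> cube k"
  shows "(\<Sum>i\<in>{1..k}. real_of_int (x i)) = 2 * real (wt k x) - real k"
proof -
  let ?A = "{i \<in> {1..k}. x i = 1}"
  have "(\<Sum>i\<in>{1..k}. real_of_int (x i)) = (\<Sum>i\<in>{1..k} - ?A. real_of_int (x i)) + (\<Sum>i\<in>?A. real_of_int (x i))"
    by (intro sum.subset_diff) auto
  also have "(\<Sum>i\<in>?A. real_of_int (x i)) = wt k x"
    by (simp add: wt_def)
  also have "(\<Sum>i\<in>{1..k} - ?A. real_of_int (x i)) = (\<Sum>i\<in>{1..k} - ?A. -1)"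
    using assms by (intro sum.cong) (auto simp: cube_iff)
  also have "\<dots> = - (real k - wt k x)"
  proof -
    have "card ({1..k} - ?A) = k - wt k x"
      unfolding wt_def by (subst card_Diff_subset) auto
    then show ?thesis using wt_le[of k x] by (simp only: sum_constant of_nat_diff) simp
  qed
  finally show ?thesis by simp
qed

section \<open>The value of kAND as a mean over the weight\<close>

lemma pmf_bern:
  assumes "p \<in> {0..1}"
  shows "pmf (bern p) 1 = p" "pmf (bern p) (-1) = 1 - p"
proof -
  have inj: "inj (\<lambda>b. if b then 1 else (-1 :: int))"
    by (auto simp: inj_def)
  show "pmf (bern p) 1 = p" "pmf (bern p) (-1) = 1 - p"
    using pmf_map_inj'[OF inj, of "bernoulli_pmf p" True] pmf_map_inj'[OF inj, of "bernoulli_pmf p" False]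
      assms by (simp_all add: bern_def)
qed

lemma set_pmf_bern_vec: "set_pmf (bern_vec k p) \<subseteq> cube k"
proof -
  have "set_pmf (bern p) \<subseteq> {-1, 1}"
    by (auto simp: bern_def)
  then show ?thesis
    by (auto simp: bern_vec_def cube_def set_Pi_pmf PiE_dflt_def)
qed

lemma pmf_bern_vec:
  assumes "p \<in> {0..1}" "a \<in> cube k"
  shows "pmf (bern_vec k p) a = p ^ wt k a * (1 - p) ^ (k - wt k a)"
proof -
  have "pmf (bern_vec k p) a = (\<Prod>i\<in>{1..k}. pmf (bern p) (a i))"
    unfolding bern_vec_def using assms(2) by (intro pmf_Pi') (auto simp: cube_iff)
  also have "\<dots> = p ^ wt k a * (1 - p) ^ (k - wt k a)"
    by (simp only: prod_cube_eq[OF assms(2), of "pmf (bern p)"] pmf_bern[OF assms(1)])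
  finally show ?thesis .
qed

text \<open>Every entry in -1, 1 is its own inverse, so the product is all-ones only for
  \<open>b = a\<close>; outside the index set both vectors have the default 0, so they agree there
  as well.\<close>

lemma sym_fun_cprod:
  assumes "a \<in> cube k" "b \<in> cube k"
  shows "sym_fun {k} k (cprod a b) = (if b = a then 1 else 0)"
proof -
  have "(\<forall>i\<in>{1..k}. cprod a b i = 1) \<longleftrightarrow> b = a"
  proof
    assume h: "\<forall>i\<in>{1..k}. cprod a b i = 1"
    show "b = a"
    proof
      fix i
      show "b i = a i"
      proof (cases "i \<in> {1..k}")
        case True
        then have "a i = 1 \<or> a i = -1" "a i * b i = 1"
          using h assms by (auto simp: cube_iff cprod_def)
        then show ?thesis by auto
      qed (use assms in \<open>simp add: cube_iff\<close>)
    qed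
  qed (use assms in \<open>auto simp: cube_iff cprod_def\<close>)
  then show ?thesis
    using kAND_eq_1_iff[of k "cprod a b"] by (auto simp: sym_fun_def)
qed

text \<open>For a fixed \<open>a\<close>, the only noise vector that counts is \<open>a\<close>
  itself, so the inner expectation is the probability that the noise equals
  \<open>a\<close>.\<close>

lemma lambda_val_kAND:
  assumes "set_pmf D \<subseteq> cube k" "p \<in> {0..1}"
  shows "lambda_val {k} k D p = measure_pmf.expectation D (\<lambda>a. p ^ wt k a * (1 - p) ^ (k - wt k a))"
proof -
  let ?B = "bern_vec k p"
  have "lambda_val {k} k D p =
      (\<Sum>z\<in>cube k \<times> cube k. pmf (pair_pmf D ?B) z *\<^sub>R (case z of (a, b) \<Rightarrow> sym_fun {k} k (cprod a b)))"
    unfolding lambda_val_def using assms(1) set_pmf_bern_vec[of k p]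
    by (intro integral_measure_pmf) auto
  also have "\<dots> = (\<Sum>a\<in>cube k. \<Sum>b\<in>cube k. pmf D a * pmf ?B b * sym_fun {k} k (cprod a b))"
    by (auto intro!: sum.cong simp: sum.cartesian_product pmf_pair)
  also have "\<dots> = (\<Sum>a\<in>cube k. \<Sum>b\<in>cube k. if b = a then pmf D a * pmf ?B a else 0)"
    by (intro sum.cong refl) (auto simp: sym_fun_cprod)
  also have "\<dots> = (\<Sum>a\<in>cube k. pmf D a *\<^sub>R (p ^ wt k a * (1 - p) ^ (k - wt k a)))"
    using assms(2) by (intro sum.cong refl) (auto simp: pmf_bern_vec)
  also have "\<dots> = measure_pmf.expectation D (\<lambda>a. p ^ wt k a * (1 - p) ^ (k - wt k a))"
    using assms(1) by (intro integral_measure_pmf[symmetric]) auto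
  finally show ?thesis .
qed

lemma integrable_cube:
  fixes f :: "(nat \<Rightarrow> int) \<Rightarrow> real"
  assumes "set_pmf D \<subseteq> cube k"
  shows "integrable (measure_pmf D) f"
  using assms finite_cube finite_subset by (intro integrable_measure_pmf_finite) blast

lemma expectation_mono_cube:
  fixes f g :: "(nat \<Rightarrow> int) \<Rightarrow> real"
  assumes "set_pmf D \<subseteq> cube k" "\<And>x. x \<in> cube k \<Longrightarrow> f x \<le> g x"
  shows "measure_pmf.expectation D f \<le> measure_pmf.expectation D g"
  using assms by (intro integral_mono_AE integrable_cube[OF assms(1)]) (auto simp: AE_measure_pmf_iff)

section \<open>Mean and gamma of a symmetric distribution\<close>

text \<open>Swapping coordinates \<open>i\<close> and \<open>j\<close> is an involution of the cube
  that preserves the weight, hence also the probabilities under \<open>D\<close>. Thus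
  \<open>mu_val\<close>, which looks at coordinate 1 only, is the mean of every coordinate.\<close>

lemma expectation_coordinate_eq:
  assumes D: "D \<in> sym_dists k" and ij: "i \<in> {1..k}" "j \<in> {1..k}"
  shows "measure_pmf.expectation D (\<lambda>x. real_of_int (x i)) = measure_pmf.expectation D (\<lambda>x. real_of_int (x j))"
proof -
  let ?t = "Transposition.transpose i j"
  let ?T = "\<lambda>x :: nat \<Rightarrow> int. x \<circ> ?t"
  have sub: "set_pmf D \<subseteq> cube k" using D by (simp add: sym_dists_def)
  have tin: "?t m \<in> {1..k} \<longleftrightarrow> m \<in> {1..k}" for m
    using ij by (auto simp: Transposition.transpose_def)
  have cube: "?T x \<in> cube k" if "x \<in> cube k" for x
    using that tin by (auto simp: cube_iff)
  have wt: "wt k (?T x) = wt k x" for x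
    unfolding wt_def
    by (rule bij_betw_same_card[of ?t], rule bij_betwI[of _ _ _ ?t])
       (use tin in \<open>auto simp: transpose_involutory\<close>)
  have pmf: "pmf D (?T x) = pmf D x" if "x \<in> cube k" for x
    using D that cube[OF that] wt[of x] unfolding sym_dists_def by blast
  have TT: "?T (?T x) = x" for x by (auto simp: fun_eq_iff)
  have E: "measure_pmf.expectation D (\<lambda>x. real_of_int (x m)) = (\<Sum>x\<in>cube k. pmf D x * x m)" for m
    using sub by (subst integral_measure_pmf[of "cube k"]) auto
  have "(\<Sum>x\<in>cube k. pmf D x * x i) = (\<Sum>x\<in>cube k. pmf D x * x j)"
    by (rule sum.reindex_bij_witness[of _ ?T ?T]) (simp_all only: TT cube pmf, simp_all)
  then show ?thesis by (simp add: E)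
qed

text \<open>The coordinates of a vector sum to \<open>2 * wt - k\<close>, and each of the
  \<open>k\<close> coordinates has mean \<open>mu_val D\<close>. This turns the constraint of equal
  means into one of equal mean weights.\<close>

lemma expectation_wt:
  assumes D: "D \<in> sym_dists k" and k: "k \<ge> 1"
  shows "measure_pmf.expectation D (\<lambda>x. real (wt k x)) = real k * (1 + mu_val D) / 2"
proof -
  have sub: "set_pmf D \<subseteq> cube k" using D by (simp add: sym_dists_def)
  note int = integrable_cube[OF sub]
  have "real k * mu_val D = (\<Sum>i\<in>{1..k}. measure_pmf.expectation D (\<lambda>x. real_of_int (x i)))"
  proof -
    have "measure_pmf.expectation D (\<lambda>x. real_of_int (x i)) = mu_val D" if "i \<in> {1..k}" for i
      unfolding mu_val_def using k that by (intro expectation_coordinate_eq[OF D]) auto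
    then show ?thesis by simp
  qed
  also have "\<dots> = measure_pmf.expectation D (\<lambda>x. \<Sum>i\<in>{1..k}. real_of_int (x i))"
    by (rule Bochner_Integration.integral_sum[symmetric]) (rule int)
  also have "\<dots> = measure_pmf.expectation D (\<lambda>x. 2 * real (wt k x) - real k)"
    using sub sum_cube_eq by (intro integral_cong_AE) (auto simp: AE_measure_pmf_iff)
  also have "\<dots> = 2 * measure_pmf.expectation D (\<lambda>x. real (wt k x)) - real k"
    by (simp add: int)
  finally show ?thesis by (simp add: field_simps)
qed

lemma gamma_val_kAND:
  assumes "set_pmf D \<subseteq> cube k"
  shows "gamma_val {k} k D = measure_pmf.expectation D (\<lambda>a. if wt k a = k then 1 else 0)"
proof -
  \<comment> \<open>At bias 1 the value is a power of 0; only weight \<open>k\<close> survives,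
    through \<open>0 ^ 0 = 1\<close>.\<close>
  have "1 ^ wt k a * (1 - 1 :: real) ^ (k - wt k a) = (if wt k a = k then 1 else 0)" for a
    using wt_le[of k a] by (simp add: power_0_left)
  then show ?thesis
    unfolding gamma_val_def using assms by (simp add: lambda_val_kAND)
qed

text \<open>The indicator of \<open>w = k\<close> is at most \<open>w / k\<close>, with equality
  exactly at the weights 0 and \<open>k\<close>.\<close>

lemma gamma_val_le:
  assumes D: "D \<in> sym_dists k" and k: "k \<ge> 1"
  shows "gamma_val {k} k D \<le> (1 + mu_val D) / 2"
proof -
  have sub: "set_pmf D \<subseteq> cube k" using D by (simp add: sym_dists_def)
  have "gamma_val {k} k D \<le> measure_pmf.expectation D (\<lambda>a. real (wt k a) / k)"
    unfolding gamma_val_kAND[OF sub] using k by (intro expectation_mono_cube[OF sub]) auto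
  also have "\<dots> = (1 + mu_val D) / 2"
    using k by (simp add: expectation_wt[OF D k])
  finally show ?thesis .
qed

section \<open>Lower bound on the ratio from a supporting line\<close>

lemma beta_val_ge:
  assumes sub: "set_pmf D \<subseteq> cube k" and p: "p \<in> {0..1}"
  shows "lambda_val {k} k D p \<le> beta_val {k} k D"
  unfolding beta_val_def
proof (rule cSUP_upper[OF p], rule bdd_aboveI2)
  fix r :: real assume r: "r \<in> {0..1}"
  have "lambda_val {k} k D r \<le> measure_pmf.expectation D (\<lambda>_. 1)"
    unfolding lambda_val_kAND[OF sub r] using r
    by (intro expectation_mono_cube[OF sub]) (auto intro!: mult_le_one power_le_one)
  then show "lambda_val {k} k D r \<le> 1" by simp
qed

text \<open>The exponential function \<open>((j + 1) / j) ^ i\<close> lies above the line through the origin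
  that meets its graph at \<open>i = j\<close> and \<open>i = j + 1\<close>.\<close>

lemma line_le_power_ratio:
  assumes "j \<ge> 1"
  shows "real i * ((real j + 1) / real j) ^ j \<le> real j * ((real j + 1) / real j) ^ i"
proof (cases "j \<le> i")
  case True
  let ?r = "(real j + 1) / real j"
  \<comment> \<open>Bernoulli's inequality for the base \<open>?r = 1 + 1 / j\<close>.\<close>
  have "real i = real j * (1 + real (i - j) * (1 / real j))"
    using assms True by (simp add: field_simps of_nat_diff)
  also have "\<dots> \<le> real j * (1 + 1 / real j) ^ (i - j)"
    by (intro mult_left_mono Bernoulli_inequality) (auto intro: order_trans[of _ 0])
  also have "1 + 1 / real j = ?r"
    using assms by (simp add: field_simps)
  finally have "real i * ?r ^ j \<le> real j * ?r ^ (i - j) * ?r ^ j"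
    by (intro mult_right_mono) auto
  also have "\<dots> = real j * ?r ^ i"
    using True by (simp add: power_add[symmetric])
  finally show ?thesis .
next
  case False
  let ?r = "(real j + 1) / real j"
  let ?s = "real j / (real j + 1)"
  have rs: "?s * ?r = 1" using assms by simp
  \<comment> \<open>Below \<open>j\<close> the inverse base \<open>?s = 1 - 1 / (j + 1)\<close> is
    used, again with Bernoulli's inequality.\<close>
  have "real i = real j - real (j - i)"
    using False by (simp add: of_nat_diff)
  also have "\<dots> \<le> real j * (1 + real (j - i) * (- 1 / (real j + 1)))"
    by (simp add: field_simps)
  also have "\<dots> \<le> real j * (1 + - 1 / (real j + 1)) ^ (j - i)"
    by (intro mult_left_mono Bernoulli_inequality) (auto simp: field_simps)
  also have "1 + - 1 / (real j + 1) = ?s"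
    by (simp add: field_simps)
  finally have "real i * ?r ^ j \<le> real j * ?s ^ (j - i) * ?r ^ j"
    by (intro mult_right_mono) auto
  also have "real j * ?s ^ (j - i) * ?r ^ j = real j * ?s ^ (j - i) * (?r ^ (j - i) * ?r ^ i)"
    using False by (simp add: power_add[symmetric])
  also have "real j * ?s ^ (j - i) * (?r ^ (j - i) * ?r ^ i) = real j * (?s * ?r) ^ (j - i) * ?r ^ i"
    by (simp only: power_mult_distrib mult_ac)
  finally show ?thesis by (simp only: rs power_one mult_1_right)
qed

text \<open>The bias with odds \<open>(j + 1) / j\<close>: for it,
  \<open>p ^ w * (1 - p) ^ (k - w)\<close> divided by \<open>w\<close> has the same value at
  \<open>w = j\<close> and \<open>w = j + 1\<close>.\<close>

definition opt_bias :: "nat \<Rightarrow> real" where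
  "opt_bias j = (real j + 1) / (2 * real j + 1)"

text \<open>The value at \<open>w = k\<close> of the line through the origin and the point of the
  graph at \<open>w = j\<close>.\<close>

definition opt_ratio :: "nat \<Rightarrow> nat \<Rightarrow> real" where
  "opt_ratio k j = real k / real j * opt_bias j ^ j * (1 - opt_bias j) ^ (k - j)"

lemma one_minus_opt_bias: "1 - opt_bias j = real j / (2 * real j + 1)"
  by (simp add: opt_bias_def field_simps)

lemma opt_bias_in: "opt_bias j \<in> {0..1}"
  by (auto simp: opt_bias_def)

text \<open>After the factor \<open>(1 - opt_bias j) ^ k\<close> is split off, the right side is the
  exponential \<open>((j + 1) / j) ^ i\<close>, which lies above the line by
  \<open>line_le_power_ratio\<close>.\<close>

lemma opt_ratio_line:
  assumes "j \<ge> 1" "j \<le> k" "i \<le> k"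
  shows "opt_ratio k j * (real i / real k) \<le> opt_bias j ^ i * (1 - opt_bias j) ^ (k - i)"
proof -
  let ?r = "(real j + 1) / real j" and ?q = "1 - opt_bias j"
  have q: "?q \<ge> 0" using opt_bias_in[of j] by auto
  have P: "opt_bias j = ?r * ?q"
    using assms(1) by (simp add: one_minus_opt_bias) (simp add: opt_bias_def)
  have eq: "opt_bias j ^ m * ?q ^ (k - m) = ?r ^ m * ?q ^ k" if "m \<le> k" for m
  proof -
    have "opt_bias j ^ m * ?q ^ (k - m) = ?r ^ m * (?q ^ m * ?q ^ (k - m))"
      using P by (metis power_mult_distrib mult.assoc)
    then show ?thesis using that by (simp add: power_add[symmetric])
  qed
  have "opt_ratio k j * (real i / real k) = real i * ?r ^ j / real j * ?q ^ k"
    using assms eq[OF assms(2)] by (simp add: opt_ratio_def mult.assoc)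
  also have "\<dots> \<le> ?r ^ i * ?q ^ k"
    using line_le_power_ratio[OF assms(1), of i] assms(1) q
    by (intro mult_right_mono) (auto simp: pos_divide_le_eq mult.commute)
  finally show ?thesis using eq[OF assms(3)] by simp
qed

text \<open>The single bias \<open>opt_bias j\<close> serves for all \<open>DN\<close>: the mean of
  the line over the weight depends on \<open>DN\<close> only through its mean, and
  \<open>gamma_val_le\<close> compares this with \<open>DY\<close>.\<close>

lemma beta_val_ge_gamma_val:
  assumes N: "DN \<in> sym_dists k" and Y: "DY \<in> sym_dists k" and mu: "mu_val DN = mu_val DY"
    and j: "j \<ge> 1" "j \<le> k"
  shows "opt_ratio k j * gamma_val {k} k DY \<le> beta_val {k} k DN"
proof -
  have sub: "set_pmf DN \<subseteq> cube k" using N by (simp add: sym_dists_def)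
  have k: "k \<ge> 1" using j by simp
  have nonneg: "opt_ratio k j \<ge> 0"
    using opt_bias_in[of j] by (simp add: opt_ratio_def)
  have "opt_ratio k j * gamma_val {k} k DY \<le> opt_ratio k j * ((1 + mu_val DN) / 2)"
    using gamma_val_le[OF Y k] nonneg unfolding mu by (rule mult_left_mono)
  also have "\<dots> = measure_pmf.expectation DN (\<lambda>x. opt_ratio k j * (real (wt k x) / real k))"
    using k by (simp add: expectation_wt[OF N k])
  also have "\<dots> \<le> lambda_val {k} k DN (opt_bias j)"
    unfolding lambda_val_kAND[OF sub opt_bias_in]
    by (intro expectation_mono_cube[OF sub] opt_ratio_line j wt_le)
  also have "\<dots> \<le> beta_val {k} k DN"
    by (intro beta_val_ge sub opt_bias_in)
  finally show ?thesis .
qed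

section \<open>Extremal distributions and the matching upper bound\<close>

text \<open>Symmetric by construction, so that choosing a symmetric distribution reduces to choosing
  a law \<open>W\<close> for the weight.\<close>

definition layer_dist :: "nat \<Rightarrow> nat pmf \<Rightarrow> (nat \<Rightarrow> int) pmf" where
  "layer_dist k W = bind_pmf W (\<lambda>i. pmf_of_set {x \<in> cube k. wt k x = i})"

text \<open>\<open>pmf_of_set\<close> has its intended meaning only on nonempty finite sets. The
  witness has its ones in the first \<open>i\<close> places.\<close>

lemma layer_nonempty:
  assumes "i \<le> k"
  shows "{x \<in> cube k. wt k x = i} \<noteq> {}"
proof -
  let ?x = "\<lambda>m. if m \<in> {1..i} then 1 else if m \<in> {1..k} then -1 else (0 :: int)"
  have "{m \<in> {1..k}. ?x m = 1} = {1..i}" using assms by auto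
  then have "wt k ?x = i" by (simp add: wt_def)
  moreover have "?x \<in> cube k" using assms by (auto simp: cube_iff)
  ultimately show ?thesis by blast
qed

lemma layer_dist_in_sym_dists:
  assumes "set_pmf W \<subseteq> {..k}"
  shows "layer_dist k W \<in> sym_dists k"
proof -
  have "set_pmf (layer_dist k W) \<subseteq> cube k"
    using assms layer_nonempty by (auto simp: layer_dist_def set_pmf_of_set)
  moreover have "pmf (layer_dist k W) x = pmf (layer_dist k W) y"
    if "x \<in> cube k" "y \<in> cube k" "wt k x = wt k y" for x y
    unfolding layer_dist_def pmf_bind using that assms layer_nonempty
    by (intro integral_cong_AE) (auto simp: AE_measure_pmf_iff indicator_def)
  ultimately show ?thesis unfolding sym_dists_def by blast
qed

lemma map_wt_layer_dist:
  assumes "set_pmf W \<subseteq> {..k}"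
  shows "map_pmf (wt k) (layer_dist k W) = W"
proof -
  have "map_pmf (wt k) (pmf_of_set {x \<in> cube k. wt k x = i}) = return_pmf i" if "i \<in> set_pmf W" for i
  proof -
    have "map_pmf (wt k) (pmf_of_set {x \<in> cube k. wt k x = i}) =
        map_pmf (\<lambda>_. i) (pmf_of_set {x \<in> cube k. wt k x = i})"
      using that assms layer_nonempty by (intro map_pmf_cong refl) (auto simp: set_pmf_of_set)
    then show ?thesis by (simp add: map_pmf_const)
  qed
  then have "map_pmf (wt k) (layer_dist k W) = bind_pmf W return_pmf"
    unfolding layer_dist_def map_bind_pmf by (intro bind_pmf_cong) auto
  then show ?thesis by (simp add: bind_return_pmf')
qed

lemma expectation_layer_dist:
  fixes g :: "nat \<Rightarrow> real"
  assumes "set_pmf W \<subseteq> {..k}"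
  shows "measure_pmf.expectation (layer_dist k W) (\<lambda>x. g (wt k x)) = measure_pmf.expectation W g"
  using integral_map_pmf[of "wt k" "layer_dist k W" g] by (simp add: map_wt_layer_dist[OF assms])

definition two_point :: "real \<Rightarrow> nat \<Rightarrow> nat \<Rightarrow> nat pmf" where
  "two_point s a b = map_pmf (\<lambda>c. if c then a else b) (bernoulli_pmf s)"

lemma expectation_two_point:
  fixes g :: "nat \<Rightarrow> real"
  assumes "s \<in> {0..1}"
  shows "measure_pmf.expectation (two_point s a b) g = s * g a + (1 - s) * g b"
  using assms by (simp add: two_point_def)

lemma set_pmf_two_point: "set_pmf (two_point s a b) \<subseteq> {a, b}"
  by (auto simp: two_point_def)

text \<open>Reduces the theorem to one polynomial inequality in \<open>p\<close>. The left side of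
  \<open>bound\<close> is the value of a distribution with mass \<open>s\<close> on weight
  \<open>j + 1\<close> and \<open>1 - s\<close> on weight \<open>j\<close>; its mean weight is
  \<open>j + s\<close>.\<close>

lemma sketch_ratio_eq_opt_ratio:
  assumes j: "j \<ge> 1" "j < k" and s: "s \<in> {0..1}"
    and bound: "\<And>p. p \<in> {0..1} \<Longrightarrow>
      s * (p ^ (j + 1) * (1 - p) ^ (k - (j + 1))) + (1 - s) * (p ^ j * (1 - p) ^ (k - j))
        \<le> opt_ratio k j * ((real j + s) / real k)"
  shows "sketch_ratio {k} k = ereal (opt_ratio k j)"
proof (rule antisym)
  \<comment> \<open>The mean weight of \<open>DN\<close> divided by \<open>k\<close>. Mass
    \<open>t\<close> on weight \<open>k\<close> and the rest on weight 0 gives \<open>DY\<close> the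
    same mean and makes \<open>gamma_val_le\<close> an equality.\<close>
  define t where "t = (real j + s) / real k"
  have k: "k \<ge> 1" "real k > 0" using j by auto
  have t: "t \<in> {0..1}" "t > 0"
    using j s by (auto simp: t_def)
  define DN where "DN = layer_dist k (two_point s (j + 1) j)"
  define DY where "DY = layer_dist k (two_point t k 0)"
  have WN: "set_pmf (two_point s (j + 1) j) \<subseteq> {..k}" and WY: "set_pmf (two_point t k 0) \<subseteq> {..k}"
    using set_pmf_two_point[of s "j + 1" j] set_pmf_two_point[of t k 0] j by auto
  have N: "DN \<in> sym_dists k" and Y: "DY \<in> sym_dists k"
    unfolding DN_def DY_def by (intro layer_dist_in_sym_dists WN WY)+
  have subN: "set_pmf DN \<subseteq> cube k" and subY: "set_pmf DY \<subseteq> cube k"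
    using N Y by (auto simp: sym_dists_def)
  have EN: "measure_pmf.expectation DN (\<lambda>x. g (wt k x)) = s * g (j + 1) + (1 - s) * g j" for g :: "nat \<Rightarrow> real"
    unfolding DN_def expectation_layer_dist[OF WN] by (rule expectation_two_point[OF s])
  have EY: "measure_pmf.expectation DY (\<lambda>x. g (wt k x)) = t * g k + (1 - t) * g 0" for g :: "nat \<Rightarrow> real"
    unfolding DY_def expectation_layer_dist[OF WY] by (rule expectation_two_point[OF t(1)])
  have "real k * (1 + mu_val DN) / 2 = real k * (1 + mu_val DY) / 2"
    unfolding expectation_wt[OF N k(1), symmetric] expectation_wt[OF Y k(1), symmetric]
      EN[of real] EY[of real] using k(2) by (simp add: t_def field_simps del: of_nat_0_less_iff)
  then have mu: "mu_val DN = mu_val DY" using k by simp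
  have gamma: "gamma_val {k} k DY = t"
    unfolding gamma_val_kAND[OF subY] EY[of "\<lambda>i. if i = k then 1 else 0"] using k by simp
  have beta: "beta_val {k} k DN \<le> opt_ratio k j * t"
    unfolding beta_val_def
  proof (rule cSUP_least)
    fix p :: real assume p: "p \<in> {0..1}"
    show "lambda_val {k} k DN p \<le> opt_ratio k j * t"
      unfolding lambda_val_kAND[OF subN p] EN[of "\<lambda>i. p ^ i * (1 - p) ^ (k - i)"] t_def
      by (rule bound[OF p])
  qed simp
  have "sketch_ratio {k} k \<le> ereal (beta_val {k} k DN / gamma_val {k} k DY)"
    unfolding sketch_ratio_def using N Y mu gamma t(2)
    by (intro INF_lower2[of "(DN, DY)"]) auto
  also have "\<dots> \<le> ereal (opt_ratio k j)"
    using beta t(2) by (simp add: gamma pos_divide_le_eq)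
  finally show "sketch_ratio {k} k \<le> ereal (opt_ratio k j)" .
next
  show "ereal (opt_ratio k j) \<le> sketch_ratio {k} k"
    unfolding sketch_ratio_def
  proof (intro INF_greatest, clarify)
    fix DN DY assume N: "DN \<in> sym_dists k" and Y: "DY \<in> sym_dists k" and mu: "mu_val DN = mu_val DY"
    have "set_pmf DY \<subseteq> cube k" using Y by (simp add: sym_dists_def)
    then have "gamma_val {k} k DY \<ge> 0"
      by (auto simp: gamma_val_kAND intro: integral_nonneg_AE)
    moreover have "opt_ratio k j * gamma_val {k} k DY \<le> beta_val {k} k DN"
      using j by (intro beta_val_ge_gamma_val N Y mu) auto
    ultimately show "ereal (opt_ratio k j) \<le>
        (if gamma_val {k} k DY = 0 then \<infinity> else ereal (beta_val {k} k DN / gamma_val {k} k DY))"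
      by (simp add: pos_le_divide_eq)
  qed
qed

section \<open>Maximising products of powers without derivatives\<close>

text \<open>A form of the inequality of arithmetic and geometric means:
  \<open>u \<le> exp (u - 1)\<close> is applied to the normalised factors \<open>x / a\<close>,
  \<open>y / b\<close> and \<open>z\<close>, and by \<open>eq\<close> the exponents add up to
  0.\<close>

lemma power_prod_le:
  fixes x y z a b :: real
  assumes nonneg: "x \<ge> 0" "y \<ge> 0" "z \<ge> 0" and pos: "a > 0" "b > 0"
    and eq: "real m * (x / a - 1) + real n * (y / b - 1) + (z - 1) = 0"
  shows "x ^ m * y ^ n * z \<le> a ^ m * b ^ n"
proof -
  have le: "u \<le> exp (u - 1)" for u :: real
    using exp_ge_add_one_self[of "u - 1"] by simp
  have "(x / a) ^ m * (y / b) ^ n * z \<le> exp (x / a - 1) ^ m * exp (y / b - 1) ^ n * exp (z - 1)"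
    using nonneg pos by (intro mult_mono power_mono le) auto
  also have "\<dots> = exp (real m * (x / a - 1) + real n * (y / b - 1) + (z - 1))"
    by (simp only: exp_add exp_of_nat_mult)
  finally have "x ^ m * y ^ n * z / (a ^ m * b ^ n) \<le> 1"
    by (simp add: eq power_divide)
  moreover have "a ^ m * b ^ n > 0" using pos by simp
  ultimately show ?thesis
    by (simp only: pos_divide_le_eq mult_1_left)
qed

text \<open>The next two identities are the vanishing hypothesis of \<open>power_prod_le\<close>; they say that
  \<open>opt_bias\<close> is a critical point of the two polynomials in \<open>p\<close> to be maximised.\<close>

lemma critical_point_odd:
  fixes n p :: real
  assumes "n > 0"
  shows "(n + 1) * (p / ((n + 1) / (2 * n + 1)) - 1) + n * ((1 - p) / (n / (2 * n + 1)) - 1) = 0"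
proof -
  have "(n + 1) * (p / ((n + 1) / (2 * n + 1)) - 1) = (2 * n + 1) * p - (n + 1)"
    using assms by (simp add: right_diff_distrib)
  moreover have "n * ((1 - p) / (n / (2 * n + 1)) - 1) = (2 * n + 1) * (1 - p) - n"
    using assms by (simp add: right_diff_distrib[of n] mult.commute)
  ultimately show ?thesis by (simp only:) (simp add: algebra_simps)
qed

lemma critical_point_even:
  fixes n p :: real
  assumes "n > 0"
  shows "n * (p / ((n + 1) / (2 * n + 1)) - 1) + (n - 1) * ((1 - p) / (n / (2 * n + 1)) - 1)
    + ((n\<^sup>2 * p + (n + 1)\<^sup>2 * (1 - p)) / (n * (n + 1)) - 1) = 0"
  using assms by (simp add: divide_simps) algebra

section \<open>The ratio for odd and even arity\<close>

text \<open>With \<open>k = 2 * j + 1\<close>, the base of \<open>alpha'\<close> is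
  \<open>j * (j + 1) / k ^ 2\<close>, the product of the two noise probabilities.\<close>

lemma alpha'_odd: "alpha' (2 * j + 1) = (opt_bias j * (1 - opt_bias j)) ^ j"
proof -
  have "(real (2 * j + 1) - 1) * (real (2 * j + 1) + 1) / (4 * (real (2 * j + 1))\<^sup>2)
      = opt_bias j * (1 - opt_bias j)"
    by (simp add: one_minus_opt_bias) (simp add: opt_bias_def power2_eq_square divide_simps, simp add: algebra_simps)
  then show ?thesis by (simp add: alpha'_def)
qed

lemma sketch_ratio_odd:
  assumes j: "j \<ge> 1"
  shows "sketch_ratio {2 * j + 1} (2 * j + 1) = ereal (alpha' (2 * j + 1))"
proof -
  let ?P = "opt_bias j" and ?Q = "1 - opt_bias j"
  have PQ: "?P > 0" "?Q > 0"
    using j by (simp_all only: one_minus_opt_bias) (simp_all add: opt_bias_def)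
  have kQ: "real (2 * j + 1) * ?Q = real j"
    unfolding one_minus_opt_bias by (simp add: add.commute[of 1])
  have ratio: "opt_ratio (2 * j + 1) j = (?P * ?Q) ^ j"
  proof -
    have "opt_ratio (2 * j + 1) j = real (2 * j + 1) * ?Q / real j * (?P ^ j * ?Q ^ j)"
      by (simp add: opt_ratio_def)
    also have "\<dots> = ?P ^ j * ?Q ^ j" using j by (simp only: kQ) simp
    finally show ?thesis by (simp add: power_mult_distrib)
  qed
  have "sketch_ratio {2 * j + 1} (2 * j + 1) = ereal (opt_ratio (2 * j + 1) j)"
  \<comment> \<open>All mass sits on weight \<open>j + 1\<close>: the value
    \<open>p ^ (j + 1) * (1 - p) ^ j\<close> is already maximal at \<open>opt_bias j\<close>, and
    the third factor in \<open>power_prod_le\<close> is 1.\<close>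
  proof (rule sketch_ratio_eq_opt_ratio[where s = 1])
    fix p :: real assume p: "p \<in> {0..1}"
    have "real (j + 1) * (p / ?P - 1) + real j * ((1 - p) / ?Q - 1) + (1 - 1) = 0"
      using critical_point_odd[of "real j" p] j
      by (simp only: one_minus_opt_bias) (simp add: opt_bias_def add.commute)
    then have "p ^ (j + 1) * (1 - p) ^ j * 1 \<le> ?P ^ (j + 1) * ?Q ^ j"
      using p PQ by (intro power_prod_le) auto
    also have "\<dots> = opt_ratio (2 * j + 1) j * ((real j + 1) / real (2 * j + 1))"
    proof -
      have "(real j + 1) / real (2 * j + 1) = ?P"
        by (simp add: opt_bias_def add.commute)
      then show ?thesis
        by (simp only: ratio) (simp add: power_mult_distrib)
    qed
    finally show "1 * (p ^ (j + 1) * (1 - p) ^ (2 * j + 1 - (j + 1))) +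
        (1 - 1) * (p ^ j * (1 - p) ^ (2 * j + 1 - j)) \<le>
        opt_ratio (2 * j + 1) j * ((real j + 1) / real (2 * j + 1))"
      by simp
  qed (use j in auto)
  then show ?thesis by (simp only: ratio alpha'_odd)
qed

text \<open>Weight \<open>j\<close> alone has its best bias at \<open>1 / 2\<close>, and weight
  \<open>j + 1\<close> alone at \<open>(j + 1) / (2 * j)\<close>. Since \<open>opt_bias j\<close>
  lies strictly between them, a proper mixture is needed.\<close>

lemma sketch_ratio_even:
  assumes j: "j \<ge> 1"
  shows "sketch_ratio {2 * j} (2 * j) = ereal (2 * alpha' (2 * j + 1))"
proof -
  let ?P = "opt_bias j" and ?Q = "1 - opt_bias j"
  have PQ: "?P > 0" "?Q > 0"
    using j by (simp_all only: one_minus_opt_bias) (simp_all add: opt_bias_def)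
  \<comment> \<open>The factor 2 is \<open>k / j\<close>.\<close>
  have ratio: "opt_ratio (2 * j) j = 2 * (?P * ?Q) ^ j"
    using j by (simp add: opt_ratio_def power_mult_distrib)
  define c where "c = (real j)\<^sup>2 + (real j + 1)\<^sup>2"
  \<comment> \<open>the mass \<open>s\<close> on weight \<open>j + 1\<close> is the one for which \<open>opt_bias j\<close> is optimal\<close>
  define s where "s = (real j)\<^sup>2 / c"
  have c: "c > 0" using j by (simp add: c_def add_pos_pos)
  have s: "s \<in> {0..1}" using c by (auto simp: s_def c_def)
  have s': "1 - s = (real j + 1)\<^sup>2 / c" using c by (simp add: s_def c_def field_simps)
  \<comment> \<open>The linear factor \<open>s * p + (1 - s) * (1 - p)\<close> of the mixture,
    rescaled to be 1 at \<open>p = opt_bias j\<close> so that it can be the factor \<open>z\<close>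
    of \<open>power_prod_le\<close>.\<close>
  define L where "L p = ((real j)\<^sup>2 * p + (real j + 1)\<^sup>2 * (1 - p)) / (real j * (real j + 1))" for p :: real
  have "sketch_ratio {2 * j} (2 * j) = ereal (opt_ratio (2 * j) j)"
  proof (rule sketch_ratio_eq_opt_ratio[OF j _ s])
    fix p :: real assume p: "p \<in> {0..1}"
    have "real j * (p / ?P - 1) + real (j - 1) * ((1 - p) / ?Q - 1) + (L p - 1) = 0"
    proof -
      have "real (j - 1) = real j - 1" using j by (simp add: of_nat_diff)
      then show ?thesis
        using critical_point_even[of "real j" p] j
        by (simp only: one_minus_opt_bias) (simp add: opt_bias_def L_def)
    qed
    then have main: "p ^ j * (1 - p) ^ (j - 1) * L p \<le> ?P ^ j * ?Q ^ (j - 1)"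
      using p PQ by (intro power_prod_le) (auto simp: L_def)
    have pow: "x ^ j = x ^ (j - 1) * x" for x :: real
      using j by (metis Suc_diff_1 power_Suc2 Suc_le_eq One_nat_def)
    have "s * (p ^ (j + 1) * (1 - p) ^ (j - 1)) + (1 - s) * (p ^ j * (1 - p) ^ j)
        = p ^ j * (1 - p) ^ (j - 1) * (s * p + (1 - s) * (1 - p))"
      by (simp add: pow[of "1 - p"] algebra_simps)
    also have "s * p + (1 - s) * (1 - p) = L p * (real j * (real j + 1) / c)"
      using j c by (simp add: s' L_def) (simp add: s_def add_divide_distrib)
    also have "p ^ j * (1 - p) ^ (j - 1) * (L p * (real j * (real j + 1) / c))
        \<le> ?P ^ j * ?Q ^ (j - 1) * (real j * (real j + 1) / c)"
      using mult_right_mono[OF main, of "real j * (real j + 1) / c"] c by (simp add: mult.assoc)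
    \<comment> \<open>One factor \<open>?Q = j / (2 * j + 1)\<close> is absorbed to raise the
      exponent \<open>j - 1\<close> to \<open>j\<close>.\<close>
    also have "\<dots> = ?P ^ j * ?Q ^ j * ((2 * real j + 1) * (real j + 1) / c)"
    proof -
      have Q: "?Q * (2 * real j + 1) = real j"
        unfolding one_minus_opt_bias by simp
      have "?P ^ j * ?Q ^ j * ((2 * real j + 1) * (real j + 1) / c)
          = ?P ^ j * ?Q ^ (j - 1) * (?Q * (2 * real j + 1) * (real j + 1) / c)"
        by (subst pow[of ?Q]) (simp only: mult_ac times_divide_eq_right)
      then show ?thesis by (simp only: Q)
    qed
    \<comment> \<open>Both sides are \<open>(j + s) / j\<close>, because
      \<open>c + j = (2 * j + 1) * (j + 1)\<close>.\<close>
    also have "(2 * real j + 1) * (real j + 1) / c = 2 * ((real j + s) / real (2 * j))"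
      using j c by (simp add: s_def field_simps) (simp add: c_def power2_eq_square algebra_simps)
    also have "?P ^ j * ?Q ^ j * (2 * ((real j + s) / real (2 * j)))
        = opt_ratio (2 * j) j * ((real j + s) / real (2 * j))"
      unfolding ratio by (simp only: power_mult_distrib mult_ac)
    finally show "s * (p ^ (j + 1) * (1 - p) ^ (2 * j - (j + 1))) +
        (1 - s) * (p ^ j * (1 - p) ^ (2 * j - j)) \<le>
        opt_ratio (2 * j) j * ((real j + s) / real (2 * j))"
      by simp
  qed (use j in auto)
  then show ?thesis by (simp only: ratio alpha'_odd)
qed

lemma alpha'_eq:
  assumes "odd k" "k \<ge> 3"
  shows "alpha' k = 1 / 2 ^ (k - 1) * (1 - 1 / (real k)\<^sup>2) ^ ((k - 1) div 2)"
proof -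
  have "(real k - 1) * (real k + 1) / (4 * (real k)\<^sup>2) = 1 / 2 ^ 2 * (1 - 1 / (real k)\<^sup>2)"
    using assms by (simp add: field_simps power2_eq_square)
  \<comment> \<open>Oddness of \<open>k\<close> makes the halved exponent exact, so the power of
    \<open>1 / 2 ^ 2\<close> becomes \<open>1 / 2 ^ (k - 1)\<close>.\<close>
  moreover have "2 * ((k - 1) div 2) = k - 1" using assms by simp
  ultimately show ?thesis
    unfolding alpha'_def by (simp only: power_mult_distrib power_one_over power_mult[symmetric])
qed

theorem theorem1p2:
  "(\<forall>k::nat. odd k \<and> k \<ge> 3 \<longrightarrow>
      alpha' k = 1 / 2 ^ (k - 1) * (1 - 1 / (real k)\<^sup>2) ^ ((k - 1) div 2)) \<and>
   (\<forall>k::nat. odd k \<and> k \<ge> 3 \<longrightarrow> sketch_ratio {k} k = ereal (alpha' k)) \<and>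
   (\<forall>k::nat. even k \<and> k \<ge> 2 \<longrightarrow> sketch_ratio {k} k = ereal (2 * alpha' (k + 1)))"
proof (intro conjI allI impI; elim conjE)
  fix k :: nat assume k: "odd k" "k \<ge> 3"
  show "alpha' k = 1 / 2 ^ (k - 1) * (1 - 1 / (real k)\<^sup>2) ^ ((k - 1) div 2)"
    by (rule alpha'_eq[OF k])
next
  fix k :: nat assume k: "odd k" "k \<ge> 3"
  then obtain j where "k = 2 * j + 1" by (elim oddE)
  then show "sketch_ratio {k} k = ereal (alpha' k)"
    using k sketch_ratio_odd[of j] by simp
next
  fix k :: nat assume k: "even k" "k \<ge> 2"
  then obtain j where "k = 2 * j" by (elim evenE)
  then show "sketch_ratio {k} k = ereal (2 * alpha' (k + 1))"
    using k sketch_ratio_even[of j] by simp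
qed

end
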